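(* There is an absolute constant $C>0$ (independent of the dimension) such that for every $n\in\mathbb{N}$, $n\ge1$, and every nonnegative $f\in L^1_{\mathrm{loc}}(\mathbb{R}^n)$, $$\mathcal{M}f(x)\le C\sqrt{n}\,\mathcal{H}_\ast f(x)$$ for almost every $x\in\mathbb{R}^n$.
   Context: $\mathcal{M}$ is the centered Hardy--Littlewood maximal function $\mathcal{M}f(x)=\sup_{r>0}\frac{1}{\omega_n r^n}\int_{B(x,r)}|f(y)|\,dy$, with $\omega_n=\pi^{n/2}/\Gamma(n/2+1)$ the volume of the unit ball of $\mathbb{R}^n$. $\mathcal{H}_\ast f(x)=\sup_{t>0}|H_tf(x)|$ is the heat maximal operator, where $H_tf=h_t*f$ and $h_t(x)=(4\pi t)^{-n/2}e^{-|x|^2/(4t)}$. For nonnegative $f$ these quantities take values in $[0,+\infty]$. *)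

theory Defs
  imports "HOL-Analysis.Analysis"
begin

text \<open>
  Points of \<open>\<real>\<^sup>n\<close> are functions \<open>nat \<Rightarrow> real\<close> in \<open>{..<n} \<rightarrow>\<^sub>E UNIV\<close>, so that the dimension is an
  ordinary natural number and the constant in the theorem can be chosen before it.
  Completing the product of the Borel measures gives Lebesgue measurability.
\<close>

definition lebesgue_Rn :: "nat \<Rightarrow> (nat \<Rightarrow> real) measure" where
  "lebesgue_Rn n = completion (Pi\<^sub>M {..<n} (\<lambda>_. lborel))"

definition norm_Rn :: "nat \<Rightarrow> (nat \<Rightarrow> real) \<Rightarrow> real" where
  "norm_Rn n x = sqrt (\<Sum>i<n. (x i)\<^sup>2)"

definition ball_Rn :: "nat \<Rightarrow> (nat \<Rightarrow> real) \<Rightarrow> real \<Rightarrow> (nat \<Rightarrow> real) set" where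
  "ball_Rn n x r = {y \<in> {..<n} \<rightarrow>\<^sub>E UNIV. norm_Rn n (\<lambda>i. y i - x i) < r}"

text \<open>
  \<^term>\<open>compact\<close> refers to the product topology on \<open>nat \<Rightarrow> real\<close>; on \<open>{..<n} \<rightarrow>\<^sub>E UNIV\<close>, where all
  coordinates outside \<open>{..<n}\<close> are constant, it induces the Euclidean topology.
\<close>

definition locally_integrable_Rn :: "nat \<Rightarrow> ((nat \<Rightarrow> real) \<Rightarrow> real) \<Rightarrow> bool" where
  "locally_integrable_Rn n f \<longleftrightarrow>
     f \<in> borel_measurable (lebesgue_Rn n) \<and>
     (\<forall>K. compact K \<and> K \<subseteq> {..<n} \<rightarrow>\<^sub>E UNIV \<longrightarrow> set_integrable (lebesgue_Rn n) K f)"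

definition hl_maximal :: "nat \<Rightarrow> ((nat \<Rightarrow> real) \<Rightarrow> real) \<Rightarrow> (nat \<Rightarrow> real) \<Rightarrow> ennreal" where
  "hl_maximal n f x =
     (SUP r\<in>{0<..}. (\<integral>\<^sup>+y\<in>ball_Rn n x r. ennreal \<bar>f y\<bar> \<partial>lebesgue_Rn n)
                      / ennreal (unit_ball_vol (real n) * r ^ n))"

definition heat_kernel :: "nat \<Rightarrow> real \<Rightarrow> (nat \<Rightarrow> real) \<Rightarrow> real" where
  "heat_kernel n t z = (4 * pi * t) powr (- (real n / 2)) * exp (- (norm_Rn n z)\<^sup>2 / (4 * t))"

text \<open>
  The following two definitions are meant for nonnegative \<open>f\<close> only: the convolution is then an
  integral with values in \<open>[0, \<infinity>]\<close>, and the absolute value in the maximal operator is redundant.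
\<close>

definition heat_op :: "nat \<Rightarrow> real \<Rightarrow> ((nat \<Rightarrow> real) \<Rightarrow> real) \<Rightarrow> (nat \<Rightarrow> real) \<Rightarrow> ennreal" where
  "heat_op n t f x =
     (\<integral>\<^sup>+y. ennreal (heat_kernel n t (\<lambda>i. x i - y i) * f y) \<partial>lebesgue_Rn n)"

definition heat_maximal :: "nat \<Rightarrow> ((nat \<Rightarrow> real) \<Rightarrow> real) \<Rightarrow> (nat \<Rightarrow> real) \<Rightarrow> ennreal" where
  "heat_maximal n f x = (SUP t\<in>{0<..}. heat_op n t f x)"

end

theory Submission
  imports Defs
begin

text \<open>
  The comparison holds pointwise at the level of kernels: at time \<open>t = r\<^sup>2 / (2 n)\<close> the heat kernel
  is smallest on \<open>B(0, r)\<close> at the boundary, and there its ratio to the normalised indicator of the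
  ball is \<open>(n/2)\<^bsup>n/2\<^esup> e\<^bsup>-n/2\<^esup> / \<Gamma>(n/2 + 1)\<close>, which by Stirling's formula is of order \<open>1 / \<surd>n\<close>.
  This choice of \<open>t\<close> maximises the boundary value of the kernel.
\<close>

text \<open>Stirling's upper bound with a crude constant 4 in place of sqrt(2 pi). Induction on
  \<open>n\<close> in steps of two moves \<open>x\<close> by 1, so the recurrence of Gamma applies.
  The bound grows by at least the factor that Gamma gains in each such step, so the constant is
  fixed by the two base cases.\<close>

lemma Gamma_half_nat_le_Stirling:
  assumes "n \<ge> 1"
  defines "x \<equiv> real n / 2"
  shows "Gamma (x + 1) \<le> 4 * exp ((x + 1/2) * ln x - x)"
  using assms(1) unfolding x_def
proof (induction n rule: less_induct)
  case (less n)
  consider "n = 1" | "n = 2" | "n > 2" using less.prems by linarith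
  then show ?case
  proof cases
    case 1
    \<comment> \<open>For \<open>n = 1\<close> the claim amounts to sqrt(pi e) \<le> 4, which
      follows from pi < 4 and e \<le> 3.\<close>
    have "sqrt pi \<le> sqrt (2\<^sup>2)" using pi_less_4 by (subst real_sqrt_le_iff) simp
    then have "sqrt pi \<le> 2" by simp
    moreover have "exp (1/2::real) \<le> 2"
    proof (rule power2_le_imp_le)
      show "(exp (1/2::real))\<^sup>2 \<le> 2\<^sup>2"
        using exp_le by (simp flip: exp_double)
    qed simp
    ultimately have "sqrt pi * exp (1/2) \<le> 2 * 2" by (intro mult_mono) auto
    then have "sqrt pi \<le> 4 * exp (- (1/2))"
      by (simp add: exp_minus field_simps)
    moreover have "Gamma (1/2 + 1 :: real) = sqrt pi / 2"
      by (subst Gamma_plus1) (auto simp: Gamma_one_half_real)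
    moreover have "exp (ln (1/2) - 1/2 :: real) = exp (- (1/2)) / 2"
      by (subst exp_diff) (simp add: exp_minus field_simps)
    ultimately show ?thesis using 1 by simp
  next
    case 2
    then show ?thesis using exp_le by (simp add: exp_minus field_simps Gamma_numeral)
  next
    case 3
    define y where "y = real (n - 2) / 2"
    have n: "real n / 2 = y + 1" and y: "y > 0"
      using 3 by (simp_all add: y_def of_nat_diff field_simps)
    have IH: "Gamma (y + 1) \<le> 4 * exp ((y + 1/2) * ln y - y)"
      using less.IH[of "n - 2"] 3 by (simp add: y_def)
    \<comment> \<open>Midpoint rule for the convex function 1/s on [y, y + 1]: its integral is at
      least its value at y + 1/2.\<close>
    have "1 / (y + 1/2) \<le> ln (y + 1) - ln y"
      using ln_inverse_approx_ge[of y "y + 1"] y by (simp add: field_simps)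
    then have key: "1 \<le> (y + 1/2) * (ln (y + 1) - ln y)"
      using y by (simp add: field_simps)
    have "Gamma (y + 1 + 1) = (y + 1) * Gamma (y + 1)"
      using y by (intro Gamma_plus1) (auto elim!: nonpos_Ints_cases)
    also have "\<dots> \<le> (y + 1) * (4 * exp ((y + 1/2) * ln y - y))"
      using IH y by (intro mult_left_mono) auto
    also have "\<dots> = 4 * exp (ln (y + 1) + ((y + 1/2) * ln y - y))"
      using y by (simp add: exp_add)
    \<comment> \<open>The two exponents differ by (y + 1/2) (ln (y + 1) - ln y) - 1, whose sign is
      exactly \<open>key\<close>.\<close>
    also have "\<dots> \<le> 4 * exp ((y + 1 + 1/2) * ln (y + 1) - (y + 1))"
      using key by (simp add: algebra_simps)
    finally show ?thesis unfolding n .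
  qed
qed

lemma one_le_heat_kernel_on_ball:
  assumes n: "n \<ge> 1" and r: "r > 0" and z: "norm_Rn n z \<le> r"
  shows "1 \<le> 4 * sqrt (real n) * (unit_ball_vol (real n) * r ^ n)
             * heat_kernel n (r\<^sup>2 / (2 * real n)) z"
proof -
  define x where "x = real n / 2"
  have x: "x > 0" and nx: "real n = 2 * x" using n by (simp_all add: x_def)
  have norm_nonneg: "0 \<le> norm_Rn n z" by (simp add: norm_Rn_def sum_nonneg)
  have G: "Gamma (x + 1) > 0" using x by simp
  have "(norm_Rn n z)\<^sup>2 \<le> r\<^sup>2" using z norm_nonneg by (intro power_mono)
  \<comment> \<open>At this time |z|^2 / (4 t) = x |z|^2 / r^2, so the worst exponent on the ball is
    -x.\<close>
  then have "- x \<le> - (norm_Rn n z)\<^sup>2 / (4 * (r\<^sup>2 / (2 * real n)))"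
    using r x by (simp add: nx field_simps)
  then have expo: "exp (- x) \<le> exp (- (norm_Rn n z)\<^sup>2 / (4 * (r\<^sup>2 / (2 * real n))))"
    by simp
  have "4 * pi * (r\<^sup>2 / (2 * real n)) = pi * r\<^sup>2 / x" using x by (simp add: nx)
  then have "(4 * pi * (r\<^sup>2 / (2 * real n))) powr (- (real n / 2))
      = exp (x * (ln x - ln pi - 2 * ln r))"
    using r x by (simp add: powr_def x_def ln_mult ln_div ln_realpow algebra_simps)
  then have kernel: "exp (x * (ln x - ln pi - 2 * ln r)) * exp (- x)
      \<le> heat_kernel n (r\<^sup>2 / (2 * real n)) z"
    unfolding heat_kernel_def using expo by simp
  have vol: "unit_ball_vol (real n) * r ^ n = exp (x * ln pi + 2 * x * ln r) / Gamma (x + 1)"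
    using r by (simp add: unit_ball_vol_def powr_def exp_add x_def flip: powr_realpow)
  have "sqrt x \<le> sqrt (real n)" using x by (simp add: nx)
  moreover have "sqrt x = exp (ln x / 2)"
    using x by (simp add: powr_def flip: powr_half_sqrt)
  ultimately have root: "exp (ln x / 2) \<le> sqrt (real n)" by simp
  have "1 \<le> 4 * exp ((x + 1/2) * ln x - x) / Gamma (x + 1)"
    using Gamma_half_nat_le_Stirling[OF n] G by (simp add: x_def)
  \<comment> \<open>The powers of pi and r cancel between the volume and the kernel bound, whose
    product is exp (x ln x - x) / Gamma (x + 1). The remaining ln x / 2 of Stirling's exponent is
    the factor sqrt x, the source of sqrt n.\<close>
  also have "\<dots> = 4 * exp (ln x / 2) * (unit_ball_vol (real n) * r ^ n)
      * (exp (x * (ln x - ln pi - 2 * ln r)) * exp (- x))"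
    unfolding vol by (simp add: algebra_simps flip: exp_add)
  also have "\<dots> \<le> 4 * sqrt (real n) * (unit_ball_vol (real n) * r ^ n)
      * heat_kernel n (r\<^sup>2 / (2 * real n)) z"
    using root kernel r by (intro mult_mono) auto
  finally show ?thesis .
qed

lemma heat_kernel_measurable:
  "(\<lambda>y. heat_kernel n t (\<lambda>i. x i - y i)) \<in> borel_measurable (lebesgue_Rn n)"
proof -
  have "(\<lambda>y. heat_kernel n t (\<lambda>i. x i - y i)) \<in> borel_measurable (Pi\<^sub>M {..<n} (\<lambda>_. lborel))"
    unfolding heat_kernel_def norm_Rn_def by measurable
  then show ?thesis unfolding lebesgue_Rn_def by (rule measurable_completion)
qed

lemma norm_Rn_minus_commute: "norm_Rn n (\<lambda>i. x i - y i) = norm_Rn n (\<lambda>i. y i - x i)"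
  by (simp add: norm_Rn_def power2_commute)

text \<open>Multiply the kernel bound by \<open>f\<close> and integrate: on the ball the indicator
  is dominated by a multiple of the heat kernel, and off the ball it vanishes while the kernel term
  is nonnegative in \<open>ennreal\<close>.\<close>

lemma ball_average_le_heat_op:
  assumes n: "n \<ge> 1" and r: "r > 0"
    and f: "f \<in> borel_measurable (lebesgue_Rn n)" "AE y in lebesgue_Rn n. 0 \<le> f y"
  shows "(\<integral>\<^sup>+y\<in>ball_Rn n x r. ennreal \<bar>f y\<bar> \<partial>lebesgue_Rn n)
           / ennreal (unit_ball_vol (real n) * r ^ n)
         \<le> ennreal (4 * sqrt (real n)) * heat_op n (r\<^sup>2 / (2 * real n)) f x"
proof -
  define c where "c = unit_ball_vol (real n) * r ^ n"
  define h where "h y = heat_kernel n (r\<^sup>2 / (2 * real n)) (\<lambda>i. x i - y i)" for y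
  have c: "c > 0" using r by (simp add: c_def)
  have h_nonneg: "0 \<le> h y" for y by (simp add: h_def heat_kernel_def)
  have meas: "(\<lambda>y. ennreal (h y * f y)) \<in> borel_measurable (lebesgue_Rn n)"
    using heat_kernel_measurable[of n _ x] f(1) unfolding h_def by measurable
  have "(\<integral>\<^sup>+y\<in>ball_Rn n x r. ennreal \<bar>f y\<bar> \<partial>lebesgue_Rn n)
      \<le> (\<integral>\<^sup>+y. ennreal (4 * sqrt (real n) * c) * ennreal (h y * f y) \<partial>lebesgue_Rn n)"
  \<comment> \<open>The sign of \<open>f\<close> is known only almost everywhere, so the integrands
    are compared almost everywhere.\<close>
  proof (rule nn_integral_mono_AE)
    show "AE y in lebesgue_Rn n. ennreal \<bar>f y\<bar> * indicator (ball_Rn n x r) y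
        \<le> ennreal (4 * sqrt (real n) * c) * ennreal (h y * f y)"
      using f(2)
    proof eventually_elim
      case (elim y)
      show ?case
      proof (cases "y \<in> ball_Rn n x r")
        case True
        then have "1 \<le> 4 * sqrt (real n) * c * h y"
          unfolding c_def h_def
          by (intro one_le_heat_kernel_on_ball n r)
             (simp add: ball_Rn_def norm_Rn_minus_commute[of n x])
        then have "1 * f y \<le> 4 * sqrt (real n) * c * h y * f y"
          using elim by (intro mult_right_mono)
        then show ?thesis
          using True elim h_nonneg[of y] c
          by (simp add: ennreal_mult'[symmetric] mult.assoc ennreal_leI)
      qed simp
    qed
  qed
  also have "\<dots> = ennreal (4 * sqrt (real n) * c) * heat_op n (r\<^sup>2 / (2 * real n)) f x"
    using meas unfolding heat_op_def h_def by (rule nn_integral_cmult)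
  also have "\<dots> = ennreal c * (ennreal (4 * sqrt (real n)) * heat_op n (r\<^sup>2 / (2 * real n)) f x)"
    using c by (simp add: ennreal_mult ac_simps)
  finally show ?thesis
    using c unfolding c_def[symmetric] by (intro divide_le_posI_ennreal) (auto simp: ac_simps)
qed

theorem mainTheorem3:
  "\<exists>C::real. C > 0 \<and>
     (\<forall>(n::nat) (f :: (nat \<Rightarrow> real) \<Rightarrow> real).
        n \<ge> 1 \<longrightarrow>
        locally_integrable_Rn n f \<longrightarrow>
        (AE y in lebesgue_Rn n. 0 \<le> f y) \<longrightarrow>
        (AE x in lebesgue_Rn n.
           hl_maximal n f x \<le> ennreal (C * sqrt (real n)) * heat_maximal n f x))"
\<comment> \<open>The constant is the 4 of the Stirling bound. The inequality is shown at every
  point \<open>x\<close>, which \<open>AE_I2\<close> turns into the almost everywhere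
  statement.\<close>
proof (rule exI[of _ 4], intro conjI allI impI AE_I2)
  fix n :: nat and f :: "(nat \<Rightarrow> real) \<Rightarrow> real" and x :: "nat \<Rightarrow> real"
  assume n: "n \<ge> 1" and f: "locally_integrable_Rn n f" "AE y in lebesgue_Rn n. 0 \<le> f y"
  show "hl_maximal n f x \<le> ennreal (4 * sqrt (real n)) * heat_maximal n f x"
    unfolding hl_maximal_def
  proof (rule SUP_least)
    fix r :: real assume "r \<in> {0<..}"
    then have r: "r > 0" by simp
    \<comment> \<open>The time varies with the radius, but the supremum over all times bounds every
      choice at once.\<close>
    have "heat_op n (r\<^sup>2 / (2 * real n)) f x \<le> heat_maximal n f x"
      unfolding heat_maximal_def using r n by (intro SUP_upper) auto
    then show "(\<integral>\<^sup>+y\<in>ball_Rn n x r. ennreal \<bar>f y\<bar> \<partial>lebesgue_Rn n)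
          / ennreal (unit_ball_vol (real n) * r ^ n)
        \<le> ennreal (4 * sqrt (real n)) * heat_maximal n f x"
      using ball_average_le_heat_op[OF n r _ f(2)] f(1)
      unfolding locally_integrable_Rn_def by (meson mult_left_mono order_trans zero_le)
  qed
qed simp

end
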